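(* Let $n\ge1$, $A,B>0$, set $p=A^2/(A^2+B^2)$ and $Z_n=\sum_{i=1}^nR_i$, where $R_1,\ldots,R_n$ are i.i.d. $\mathrm{Bernoulli}(p)$. Then for $u\in\mathbb{R}$, $$\tilde P_{2,n}(u)=P_2\big(np+u(1-p)/B;\,Z_n\big),$$ where $P_2(x;Z_n)=1$ for $x\le np$ and $$P_2(x;Z_n):=\begin{cases} \dfrac{np(1-p)}{(x-np)^2+np(1-p)},& np<x\le\Psi_0,\\[6pt] \dfrac{v_kp_k-e_k^2}{x^2p_k-2xe_k+v_k},&\Psi_{k-1}<x\le\Psi_k\ \ (1\le k\le n-1),\\[6pt] \mathbb{P}(Z_n=n)=p^n,& x\ge\Psi_{n-1}=n.\end{cases}$$ Here $p_k=\mathbb{P}(Z_n\ge k)$, $e_k=\mathbb{E}[Z_n\mathbf{1}\{Z_n\ge k\}]$, $v_k=\mathbb{E}[Z_n^2\mathbf{1}\{Z_n\ge k\}]$ and $\Psi_k=(v_k-ke_k)/(e_k-kp_k)$.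
   Context: Write $(a)_+=\max\{a,0\}$ and $(a)_+^2=((a)_+)^2$. Let $G_1,\ldots,G_n$ be independent with $\mathbb{P}(G_i=-A^2/B)=B^2/(A^2+B^2)$ and $\mathbb{P}(G_i=B)=A^2/(A^2+B^2)$ (the equal-variance case), and define $$\tilde P_{2,n}(u)=\inf_{x\le u}\frac{\mathbb{E}[(\sum_{i=1}^nG_i-x)_+^2]}{(u-x)_+^2},\qquad u\in\mathbb{R}.$$
   Formalization: The identity is proved for u ≤ nB; for u > nB the printed value pⁿ is false (x = nB makes the quotient 0), and the infimum is proved to be 0 instead. At x = u the quotient 0/0 is read as +∞. *)

theory Defs
  imports "HOL-Probability.Probability"
begin

text \<open>Quotient \<open>a / b\<close> of nonnegative reals with the convention \<open>a / 0 = \<infinity>\<close>, including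
  \<open>0 / 0 = \<infinity>\<close>.  (Division on \<^typ>\<open>ereal\<close> has \<open>0 / 0 = 0\<close>, which would make the infimum below
  vanish whenever \<open>u\<close> is the largest value of the sum.)\<close>

definition ext_quot :: "real \<Rightarrow> real \<Rightarrow> ereal" where
  "ext_quot a b = (if b = 0 then \<infinity> else ereal (a / b))"

definition P2_tilde :: "'a measure \<Rightarrow> nat \<Rightarrow> (nat \<Rightarrow> 'a \<Rightarrow> real) \<Rightarrow> real \<Rightarrow> ereal" where
  "P2_tilde M n G u =
     (INF x\<in>{..u}. ext_quot (\<integral>\<omega>. (max ((\<Sum>i=1..n. G i \<omega>) - x) 0)\<^sup>2 \<partial>M) ((max (u - x) 0)\<^sup>2))"

definition tail_p :: "'b measure \<Rightarrow> ('b \<Rightarrow> real) \<Rightarrow> nat \<Rightarrow> real" where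
  "tail_p N Z k = measure N {\<omega> \<in> space N. Z \<omega> \<ge> real k}"

definition tail_e :: "'b measure \<Rightarrow> ('b \<Rightarrow> real) \<Rightarrow> nat \<Rightarrow> real" where
  "tail_e N Z k = (\<integral>\<omega>. Z \<omega> * indicat_real {real k..} (Z \<omega>) \<partial>N)"

definition tail_v :: "'b measure \<Rightarrow> ('b \<Rightarrow> real) \<Rightarrow> nat \<Rightarrow> real" where
  "tail_v N Z k = (\<integral>\<omega>. (Z \<omega>)\<^sup>2 * indicat_real {real k..} (Z \<omega>) \<partial>N)"

definition Psi :: "'b measure \<Rightarrow> ('b \<Rightarrow> real) \<Rightarrow> nat \<Rightarrow> real" where
  "Psi N Z k = (tail_v N Z k - real k * tail_e N Z k) / (tail_e N Z k - real k * tail_p N Z k)"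

text \<open>The piecewise definition, as the unique value satisfying every clause whose condition holds:
  the last clause overlaps an earlier one at \<open>x = Psi N Z (n - 1)\<close>, and no precedence between
  clauses is imposed.\<close>

definition P2 :: "'b measure \<Rightarrow> ('b \<Rightarrow> real) \<Rightarrow> nat \<Rightarrow> real \<Rightarrow> real \<Rightarrow> real" where
  "P2 N Z n p x = (THE y.
     (x \<le> n * p \<longrightarrow> y = 1) \<and>
     (n * p < x \<and> x \<le> Psi N Z 0 \<longrightarrow>
        y = n * p * (1 - p) / ((x - n * p)\<^sup>2 + n * p * (1 - p))) \<and>
     (\<forall>k. 1 \<le> k \<and> k \<le> n - 1 \<and> Psi N Z (k - 1) < x \<and> x \<le> Psi N Z k \<longrightarrow>
        y = (tail_v N Z k * tail_p N Z k - (tail_e N Z k)\<^sup>2) /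
            (x\<^sup>2 * tail_p N Z k - 2 * x * tail_e N Z k + tail_v N Z k)) \<and>
     (x \<ge> Psi N Z (n - 1) \<longrightarrow> y = measure N {\<omega> \<in> space N. Z \<omega> = real n}))"

end

theory Submission
  imports Defs "HOL-Real_Asymp.Real_Asymp"
begin

text \<open>Both sums are affine images of a binomial variable \<open>S\<close>, so after rescaling the infimum is that
  of \<open>E (S - y)\<^sub>+\<^sup>2 / (w - y)\<^sup>2\<close> over \<open>y < w\<close>.  For \<open>E S < w \<le> n\<close> it is attained at a \<open>z\<close> for
  which the mean of \<open>S\<close> under the weight \<open>(S - z)\<^sub>+\<close> equals \<open>w\<close>.  On \<open>k - 1 \<le> z \<le> k\<close> the truncated moments are
  quadratic in \<open>z\<close>, so this equation can be solved explicitly; \<open>Psi k\<close> is the value of \<open>w\<close>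
  for which the solution is \<open>z = k\<close>.\<close>

section \<open>Minimising the quotient for a law on 0, ..., n\<close>

lemma Inf_ext_quot_eq:
  fixes f :: "real \<Rightarrow> real"
  assumes "\<And>y. y < w \<Longrightarrow> f z / (w - z)\<^sup>2 \<le> f y / (w - y)\<^sup>2" and "z < w"
  shows "(INF y\<in>{..w}. ext_quot (f y) ((max (w - y) 0)\<^sup>2)) = ereal (f z / (w - z)\<^sup>2)"
proof (rule antisym)
  show "(INF y\<in>{..w}. ext_quot (f y) ((max (w - y) 0)\<^sup>2)) \<le> ereal (f z / (w - z)\<^sup>2)"
    using \<open>z < w\<close> by (intro INF_lower2[of z]) (auto simp: ext_quot_def)
next
  show "ereal (f z / (w - z)\<^sup>2) \<le> (INF y\<in>{..w}. ext_quot (f y) ((max (w - y) 0)\<^sup>2))"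
  proof (rule INF_greatest)
    fix y assume "y \<in> {..w}"
    \<comment> \<open>At the endpoint \<open>y = w\<close> the quotient is infinite by the
      convention in \<open>ext_quot\<close>, so only \<open>y < w\<close> matters.\<close>
    then show "ereal (f z / (w - z)\<^sup>2) \<le> ext_quot (f y) ((max (w - y) 0)\<^sup>2)"
      using assms(1)[of y] by (cases "y = w") (auto simp: ext_quot_def)
  qed
qed

text \<open>Strict positivity of every mass keeps the denominators below positive:
  \<open>mom 0 k\<close> for \<open>k \<le> n\<close>, and for \<open>k < n\<close> those of
  \<open>psi k\<close> and of the closed forms.\<close>

locale lattice_law =
  fixes b :: "nat \<Rightarrow> real" and n :: nat
  assumes n_pos: "1 \<le> n" and b_pos: "\<And>j. j \<le> n \<Longrightarrow> 0 < b j" and total: "(\<Sum>j\<le>n. b j) = 1"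
begin

text \<open>For \<open>r\<close> = 0, 1, 2 these are the quantities p_k, e_k, v_k of the piecewise
  formula.\<close>

definition mom :: "nat \<Rightarrow> nat \<Rightarrow> real" where
  "mom r k = (\<Sum>j=k..n. b j * real j ^ r)"

definition stop_loss :: "nat \<Rightarrow> real \<Rightarrow> real" where
  "stop_loss r y = (\<Sum>j\<le>n. b j * max (real j - y) 0 ^ r)"

text \<open>For \<open>k < n\<close> this is the mean of the atoms under the weights
  \<open>b j * max (j - k) 0\<close>.\<close>

definition psi :: "nat \<Rightarrow> real" where
  "psi k = (mom 2 k - real k * mom 1 k) / (mom 1 k - real k * mom 0 k)"

definition bound :: "real \<Rightarrow> ereal" where
  "bound w = (INF y\<in>{..w}. ext_quot (stop_loss 2 y) ((max (w - y) 0)\<^sup>2))"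

lemma mom0_pos: "k \<le> n \<Longrightarrow> 0 < mom 0 k"
  unfolding mom_def using b_pos by (intro sum_pos) auto

lemma mom_0_0: "mom 0 0 = 1"
  using total by (simp add: mom_def atLeast0AtMost)

text \<open>If the weighted mean of the atoms under the weights \<open>b j * max (j - z) 0\<close> is \<open>w\<close>, then \<open>z\<close>
  minimises the quotient: apply \<open>s\<^sup>2 \<ge> 2 \<lambda> s t - \<lambda>\<^sup>2 t\<^sup>2\<close> to each atom with
  \<open>\<lambda> = (w - y) / (w - z)\<close>.\<close>

lemma stop_loss_quotient_minimal:
  assumes z: "z < w" and y: "y < w" and cert: "stop_loss 2 z = (w - z) * stop_loss 1 z"
  shows "stop_loss 2 z / (w - z)\<^sup>2 \<le> stop_loss 2 y / (w - y)\<^sup>2"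
proof -
  define l where "l = (w - y) / (w - z)"
  have l: "0 < l" "l * (w - z) = w - y" using z y by (auto simp: l_def)
  have "2 * l * (stop_loss 2 z + (z - y) * stop_loss 1 z) - l\<^sup>2 * stop_loss 2 z =
     (\<Sum>j\<le>n. b j * (2 * l * (max (real j - z) 0 ^ 2 + (z - y) * max (real j - z) 0) - l\<^sup>2 * max (real j - z) 0 ^ 2))"
    unfolding stop_loss_def
    by (simp add: algebra_simps sum.distrib sum_subtractf sum_distrib_left)
  also have "\<dots> \<le> stop_loss 2 y"
    unfolding stop_loss_def
  proof (intro sum_mono mult_left_mono)
    fix j assume "j \<in> {..n}"
    then show "0 \<le> b j" using b_pos[of j] by simp
    define s where "s = max (real j - y) 0"
    define t where "t = max (real j - z) 0"
    have "0 \<le> t" by (simp add: t_def)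
    \<comment> \<open>Where \<open>t\<close> is nonzero, \<open>real j - y = t + (z - y)\<close>.
      This bounds the cross term \<open>t * s\<close> from below by an expression whose sum involves
      only moments truncated at \<open>z\<close>.\<close>
    have "t\<^sup>2 + (z - y) * t = t * (real j - y)"
      by (auto simp: t_def max_def power2_eq_square algebra_simps)
    also have "\<dots> \<le> t * s" using \<open>0 \<le> t\<close> by (intro mult_left_mono) (auto simp: s_def)
    finally have "2 * l * (t\<^sup>2 + (z - y) * t) \<le> 2 * l * (t * s)" using l by simp
    moreover have "0 \<le> (s - l * t)\<^sup>2" by simp
    ultimately show "2 * l * (t\<^sup>2 + (z - y) * t) - l\<^sup>2 * t\<^sup>2 \<le> s\<^sup>2"
      by (simp add: power2_eq_square algebra_simps)
  qed
  finally have *: "2 * l * (stop_loss 2 z + (z - y) * stop_loss 1 z) - l\<^sup>2 * stop_loss 2 z \<le> stop_loss 2 y" .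
  \<comment> \<open>By \<open>cert\<close> the linear term equals
    \<open>2 * l\<^sup>2 * stop_loss 2 z\<close>, and subtracting the quadratic term leaves exactly
    \<open>l\<^sup>2 * stop_loss 2 z\<close>.\<close>
  have "stop_loss 2 z + (z - y) * stop_loss 1 z = l * stop_loss 2 z"
  proof -
    have "stop_loss 2 z + (z - y) * stop_loss 1 z = (w - y) * stop_loss 1 z"
      unfolding cert by (simp add: algebra_simps)
    also have "\<dots> = l * stop_loss 2 z" unfolding cert l(2)[symmetric] by simp
    finally show ?thesis .
  qed
  with * have "l\<^sup>2 * stop_loss 2 z \<le> stop_loss 2 y" by (simp add: power2_eq_square)
  then show ?thesis using z y by (simp add: l_def field_simps)
qed

text \<open>Evaluating \<open>bound\<close> above the mean thus amounts to exhibiting a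
  \<open>z\<close> that solves the stationarity equation.\<close>

lemma bound_eq:
  assumes "z < w" "stop_loss 2 z = (w - z) * stop_loss 1 z"
  shows "bound w = ereal (stop_loss 2 z / (w - z)\<^sup>2)"
  unfolding bound_def using assms stop_loss_quotient_minimal by (intro Inf_ext_quot_eq) auto

section \<open>Truncated moments as tail polynomials\<close>

text \<open>Atoms below \<open>k\<close> are at most \<open>k - 1\<close>, hence at most
  \<open>y\<close>, and contribute \<open>0 ^ r = 0\<close> because \<open>r\<close> is positive.
  For \<open>k = 0\<close> there are no such atoms, so \<open>y\<close> may be arbitrarily
  negative.\<close>

lemma stop_loss_eq_tail:
  assumes "y \<le> real k" "k = 0 \<or> real k - 1 \<le> y" "0 < r"
  shows "stop_loss r y = (\<Sum>j=k..n. b j * (real j - y) ^ r)"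
proof -
  have "stop_loss r y = (\<Sum>j=k..n. b j * max (real j - y) 0 ^ r)"
    unfolding stop_loss_def
  proof (rule sum.mono_neutral_right)
    show "\<forall>i\<in>{..n} - {k..n}. b i * max (real i - y) 0 ^ r = 0"
    proof
      fix i assume "i \<in> {..n} - {k..n}"
      then have "real i \<le> y" using assms(2) by (auto simp: not_le)
      then show "b i * max (real i - y) 0 ^ r = 0" using \<open>0 < r\<close> by (simp add: max_def)
    qed
  qed auto
  also have "\<dots> = (\<Sum>j=k..n. b j * (real j - y) ^ r)"
  proof (rule sum.cong)
    fix j assume "j \<in> {k..n}"
    then have "real k \<le> real j" by simp
    then have "y \<le> real j" using assms(1) by linarith
    then show "b j * max (real j - y) 0 ^ r = b j * (real j - y) ^ r" by simp
  qed simp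
  finally show ?thesis .
qed

lemma sum_tail_linear: "(\<Sum>j=k..n. b j * (real j - y)) = mom 1 k - y * mom 0 k"
  by (simp add: mom_def algebra_simps sum_subtractf flip: sum_distrib_left)

lemma sum_tail_square: "(\<Sum>j=k..n. b j * (real j - y)\<^sup>2) = mom 2 k - 2 * y * mom 1 k + y\<^sup>2 * mom 0 k"
  by (simp add: mom_def power2_diff algebra_simps sum_subtractf sum.distrib sum_distrib_left sum_distrib_right)

text \<open>The tail sum of squares is nonnegative; centring it at the tail mean gives the
  inequality.\<close>

lemma mom_cauchy_schwarz: "k \<le> n \<Longrightarrow> (mom 1 k)\<^sup>2 \<le> mom 2 k * mom 0 k"
proof -
  assume k: "k \<le> n"
  let ?m = "mom 1 k / mom 0 k"
  have "0 \<le> (\<Sum>j=k..n. b j * (real j - ?m)\<^sup>2)"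
    using b_pos by (intro sum_nonneg mult_nonneg_nonneg) (auto intro: less_imp_le)
  then have "0 \<le> mom 2 k - 2 * ?m * mom 1 k + ?m\<^sup>2 * mom 0 k" by (simp only: sum_tail_square)
  also have "\<dots> = mom 2 k - (mom 1 k)\<^sup>2 / mom 0 k"
    using mom0_pos[OF k] by (simp add: field_simps power2_eq_square)
  finally show ?thesis using mom0_pos[OF k] by (simp add: field_simps)
qed

text \<open>For \<open>k < n\<close> the tail contains the distinct atoms \<open>k\<close> and
  \<open>n\<close>, and \<open>w\<close> cannot equal both.\<close>

lemma sum_tail_square_pos:
  assumes "k < n" shows "0 < mom 2 k - 2 * w * mom 1 k + w\<^sup>2 * mom 0 k"
proof -
  define i where "i = (if w = real n then k else n)"
  have i: "i \<in> {k..n}" "real i \<noteq> w" using assms by (auto simp: i_def)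
  have "0 < (\<Sum>j=k..n. b j * (real j - w)\<^sup>2)"
  proof (rule sum_pos2[of _ i])
    show "0 < b i * (real i - w)\<^sup>2" using i b_pos[of i] by simp
    show "0 \<le> b j * (real j - w)\<^sup>2" if "j \<in> {k..n}" for j
      using that b_pos[of j] by simp
  qed (use i in auto)
  then show ?thesis by (simp only: sum_tail_square)
qed

lemma tail_denom_pos:
  assumes "k < n" shows "0 < mom 1 k - real k * mom 0 k"
proof -
  have "0 < (\<Sum>j=k..n. b j * (real j - real k))"
    by (rule sum_pos2[of _ n]) (use assms b_pos in \<open>auto intro!: mult_nonneg_nonneg intro: less_imp_le\<close>)
  then show ?thesis by (simp only: sum_tail_linear)
qed

lemma mom_Suc: "k \<le> n \<Longrightarrow> mom r k = b k * real k ^ r + mom r (Suc k)"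
  unfolding mom_def by (simp add: sum.atLeast_Suc_atMost)

text \<open>The atom \<open>k\<close> has weight zero in \<open>psi k\<close>, so the sums may start
  one later. Both ends of the interval from \<open>psi (k - 1)\<close> to \<open>psi k\<close> can
  then be written with the moments of the same tail.\<close>

lemma psi_Suc:
  assumes "k < n"
  shows "psi k = (mom 2 (Suc k) - real k * mom 1 (Suc k)) / (mom 1 (Suc k) - real k * mom 0 (Suc k))"
  unfolding psi_def using assms by (simp add: mom_Suc algebra_simps power2_eq_square)

text \<open>The weights \<open>max (j - (n - 1)) 0\<close> charge only the atom
  \<open>n\<close>.\<close>

lemma psi_last: "psi (n - 1) = real n"
proof -
  obtain m where m: "n = Suc m" using n_pos by (cases n) auto
  have last: "mom r n = b n * real n ^ r" for r
    by (simp add: mom_def)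
  have "psi m = (real n ^ 2 - real m * real n) * b n / ((real n - real m) * b n)"
    using psi_Suc[of m] unfolding m[symmetric] last by (simp add: m algebra_simps)
  also have "\<dots> = real n" using b_pos[of n] m by (simp add: power2_eq_square field_simps)
  finally show ?thesis by (simp add: m)
qed

section \<open>The infimum, region by region\<close>

text \<open>With the tail polynomials the stationarity equation reads v - 2ze + z^2 p = (w - z)(e -
  zp). The terms in z^2 cancel, leaving a linear equation whose root is the given \<open>z\<close>.
  The condition \<open>D\<close> puts \<open>w\<close> above the tail mean, which makes the
  denominator of the root positive and yields \<open>z < w\<close>.\<close>

lemma bound_tail:
  assumes k: "k < n" and D: "mom 1 k < w * mom 0 k"
    and z: "z = (w * mom 1 k - mom 2 k) / (w * mom 0 k - mom 1 k)"
    and "z \<le> real k" "k = 0 \<or> real k - 1 \<le> z"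
  shows "bound w = ereal ((mom 2 k * mom 0 k - (mom 1 k)\<^sup>2) / (w\<^sup>2 * mom 0 k - 2 * w * mom 1 k + mom 2 k))"
proof -
  define d where "d = w * mom 0 k - mom 1 k"
  define q where "q = w\<^sup>2 * mom 0 k - 2 * w * mom 1 k + mom 2 k"
  have d: "0 < d" using D by (simp add: d_def)
  have q: "0 < q" using sum_tail_square_pos[OF k, of w] by (simp add: q_def)
  have zd: "z * d = w * mom 1 k - mom 2 k" using d by (simp add: z d_def)
  have wz: "w - z = q / d"
    using d zd by (simp add: field_simps) (simp add: q_def d_def algebra_simps power2_eq_square)
  have H2: "stop_loss 2 z = mom 2 k - 2 * z * mom 1 k + z\<^sup>2 * mom 0 k"
    using stop_loss_eq_tail[of z k 2] assms(4,5) sum_tail_square by simp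
  have H1: "stop_loss 1 z = mom 1 k - z * mom 0 k"
    using stop_loss_eq_tail[of z k 1] assms(4,5) sum_tail_linear by simp
  have "(w - z) * stop_loss 1 z = mom 1 k * w - z * d - z * mom 1 k - z * mom 1 k + z\<^sup>2 * mom 0 k"
    unfolding H1 d_def by (simp add: algebra_simps power2_eq_square)
  then have cert: "stop_loss 2 z = (w - z) * stop_loss 1 z" unfolding zd H2 by simp
  have "d * stop_loss 1 z = d * mom 1 k - (z * d) * mom 0 k" unfolding H1 by (simp add: algebra_simps)
  then have "d * stop_loss 1 z = mom 2 k * mom 0 k - (mom 1 k)\<^sup>2"
    unfolding zd by (simp add: d_def algebra_simps power2_eq_square)
  moreover have "stop_loss 2 z / (w - z)\<^sup>2 = d * stop_loss 1 z / q"
    unfolding cert using d q by (simp add: wz power2_eq_square field_simps)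
  moreover have "z < w" using wz d q by (metis diff_gt_0_iff_gt divide_pos_pos)
  ultimately show ?thesis using bound_eq[OF _ cert] by (simp add: q_def)
qed

text \<open>For \<open>k = 0\<close> only \<open>z \<le> 0\<close> has to be checked, which amounts
  to \<open>w \<le> psi 0\<close>. The value is Cantelli's bound, since the denominator is the
  variance plus \<open>(w - mom 1 0)\<^sup>2\<close>.\<close>

lemma bound_first:
  assumes "mom 1 0 < w" "w \<le> psi 0"
  shows "bound w = ereal ((mom 2 0 - (mom 1 0)\<^sup>2) / (w\<^sup>2 - 2 * w * mom 1 0 + mom 2 0))"
proof -
  have n: "0 < n" using n_pos by simp
  have e: "0 < mom 1 0" using tail_denom_pos[OF n] by simp
  have "w * mom 1 0 \<le> mom 2 0" using assms(2) e by (simp add: psi_def field_simps)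
  then show ?thesis
    using bound_tail[OF n, of w] assms(1)
    by (simp add: mom_0_0 divide_le_0_iff)
qed

text \<open>The two bounds on \<open>w\<close> say precisely that the explicit root lies above
  \<open>k - 1\<close> and is at most \<open>k\<close>.\<close>

lemma bound_middle:
  assumes k: "1 \<le> k" "k \<le> n - 1" and w: "psi (k - 1) < w" "w \<le> psi k"
  shows "bound w = ereal ((mom 2 k * mom 0 k - (mom 1 k)\<^sup>2) / (w\<^sup>2 * mom 0 k - 2 * w * mom 1 k + mom 2 k))"
proof -
  define c where "c = real k - 1"
  have kn: "k < n" using k by simp
  have m0: "0 < mom 0 k" using mom0_pos kn by simp
  have a: "0 < mom 1 k - real k * mom 0 k" using tail_denom_pos[OF kn] .
  then have a': "0 < mom 1 k - c * mom 0 k" using m0 by (simp add: c_def algebra_simps)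
  have psi': "psi (k - 1) = (mom 2 k - c * mom 1 k) / (mom 1 k - c * mom 0 k)"
    using psi_Suc[of "k - 1"] k kn by (simp add: c_def of_nat_diff)
  have w1: "mom 2 k - c * mom 1 k < w * (mom 1 k - c * mom 0 k)"
    using w(1) a' unfolding psi' by (simp add: field_simps)
  have w2: "w * (mom 1 k - real k * mom 0 k) \<le> mom 2 k - real k * mom 1 k"
    using w(2) a unfolding psi_def by (simp add: field_simps)
  \<comment> \<open>By Cauchy-Schwarz \<open>psi (k - 1)\<close> is at least the tail mean
    \<open>mom 1 k / mom 0 k\<close>, so \<open>w\<close> exceeds that mean.\<close>
  have "mom 1 k * (mom 1 k - c * mom 0 k) \<le> mom 0 k * (mom 2 k - c * mom 1 k)"
    using mom_cauchy_schwarz[of k] kn by (simp add: algebra_simps power2_eq_square)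
  also have "\<dots> < mom 0 k * (w * (mom 1 k - c * mom 0 k))" using w1 m0 by simp
  also have "\<dots> = (w * mom 0 k) * (mom 1 k - c * mom 0 k)" by simp
  finally have D: "mom 1 k < w * mom 0 k" using a' by (simp only: mult_less_cancel_right_pos)
  show ?thesis
  proof (rule bound_tail[OF kn D refl])
    show "(w * mom 1 k - mom 2 k) / (w * mom 0 k - mom 1 k) \<le> real k"
      using D w2 by (simp add: divide_le_eq algebra_simps)
    have "real k - 1 \<le> (w * mom 1 k - mom 2 k) / (w * mom 0 k - mom 1 k)"
      using D w1 by (simp add: le_divide_eq c_def algebra_simps)
    then show "k = 0 \<or> real k - 1 \<le> (w * mom 1 k - mom 2 k) / (w * mom 0 k - mom 1 k)" ..
  qed
qed

text \<open>The minimiser is \<open>z = n - 1\<close>: only the atom \<open>n\<close> lies above it,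
  with excess 1, so all truncated moments of positive order equal \<open>b n\<close>.\<close>

lemma bound_last: "bound (real n) = ereal (b n)"
proof -
  have "stop_loss r (real n - 1) = b n" if "0 < r" for r
    using that by (subst stop_loss_eq_tail[of _ n]) auto
  then show ?thesis using bound_eq[of "real n - 1" "real n"] by simp
qed

text \<open>At \<open>z = n\<close> both truncated moments vanish and the stationarity equation
  reads 0 = 0.\<close>

lemma bound_beyond:
  assumes "real n < w" shows "bound w = 0"
proof -
  have "stop_loss 2 (real n) = 0" "stop_loss 1 (real n) = 0"
    unfolding stop_loss_def by (auto simp: max_def)
  then show ?thesis using bound_eq[OF assms] by (simp add: zero_ereal_def)
qed

text \<open>Here the infimum is a limit: the quotient tends to 1 as \<open>y\<close> tends to minus
  infinity.\<close>

lemma bound_below_mean: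
  assumes w: "w \<le> mom 1 0" shows "bound w = 1"
proof (rule antisym)
  have lim: "((\<lambda>y. (v - 2 * y * e + y\<^sup>2) / (w - y)\<^sup>2) \<longlongrightarrow> 1) at_bot" for v e :: real
    by real_asymp
  show "bound w \<le> 1"
    unfolding one_ereal_def
  proof (rule tendsto_lowerbound[OF tendsto_ereal[OF lim]])
    show "\<forall>\<^sub>F y in at_bot. bound w \<le> ereal ((mom 2 0 - 2 * y * mom 1 0 + y\<^sup>2) / (w - y)\<^sup>2)"
      \<comment> \<open>Below 0 the truncation is inactive, and below \<open>w\<close> the
        denominator is nonzero.\<close>
      using eventually_gt_at_bot[of "min w 0"]
    proof eventually_elim
      fix y assume y: "y < min w 0"
      have "bound w \<le> ext_quot (stop_loss 2 y) ((max (w - y) 0)\<^sup>2)"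
        unfolding bound_def using y by (intro INF_lower) auto
      also have "\<dots> = ereal (stop_loss 2 y / (w - y)\<^sup>2)" using y by (simp add: ext_quot_def)
      also have "stop_loss 2 y = mom 2 0 - 2 * y * mom 1 0 + y\<^sup>2"
        using y stop_loss_eq_tail[of y 0 2] sum_tail_square[of y 0] by (simp add: mom_0_0)
      finally show "bound w \<le> ereal ((mom 2 0 - 2 * y * mom 1 0 + y\<^sup>2) / (w - y)\<^sup>2)" .
    qed
  qed simp
next
  show "1 \<le> bound w"
    unfolding bound_def
  proof (rule INF_greatest)
    fix y assume y: "y \<in> {..w}"
    show "1 \<le> ext_quot (stop_loss 2 y) ((max (w - y) 0)\<^sup>2)"
    proof (cases "y = w")
      case False
      define d where "d = w - y"
      have d: "0 < d" using y False by (simp add: d_def)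
      \<comment> \<open>Averaging the tangent inequality
        \<open>s\<^sup>2 \<ge> 2 * d * s - d\<^sup>2\<close> gives the lower bound, because the mean
        minus \<open>y\<close> is at least \<open>d\<close>.\<close>
      have "2 * d * (mom 1 0 - y * mom 0 0) - d\<^sup>2 * mom 0 0 = (\<Sum>j\<le>n. b j * (2 * d * (real j - y) - d\<^sup>2))"
        unfolding sum_tail_linear[symmetric]
        by (simp add: mom_def atLeast0AtMost algebra_simps sum_subtractf sum.distrib sum_distrib_left sum_distrib_right)
      also have "\<dots> \<le> stop_loss 2 y"
        unfolding stop_loss_def
      proof (intro sum_mono mult_left_mono)
        fix j assume "j \<in> {..n}"
        then show "0 \<le> b j" using b_pos[of j] by simp
        define s where "s = max (real j - y) 0"
        have "2 * d * (real j - y) \<le> 2 * d * s" using d by (simp add: s_def)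
        moreover have "0 \<le> (s - d)\<^sup>2" by simp
        ultimately show "2 * d * (real j - y) - d\<^sup>2 \<le> s\<^sup>2"
          by (simp add: power2_eq_square algebra_simps)
      qed
      finally have "2 * d * (mom 1 0 - y) - d\<^sup>2 \<le> stop_loss 2 y" by (simp add: mom_0_0)
      moreover have "2 * d * d \<le> 2 * d * (mom 1 0 - y)" using d w by (simp add: d_def)
      ultimately have "d\<^sup>2 \<le> stop_loss 2 y" by (simp add: power2_eq_square)
      then show ?thesis using d by (simp add: ext_quot_def d_def one_ereal_def)
    qed (simp add: ext_quot_def)
  qed
qed

end

section \<open>Laws of sums of independent two-point variables\<close>

text \<open>Independence makes the joint law the product of the marginals, so the marginals
  determine the law of the sum, even across different probability spaces.\<close>

lemma distr_sum_cong:
  fixes X :: "'i \<Rightarrow> 'a \<Rightarrow> real" and Y :: "'i \<Rightarrow> 'b \<Rightarrow> real"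
  assumes "prob_space M" "prob_space N" "I \<noteq> {}"
    and X: "prob_space.indep_vars M (\<lambda>_. borel) X I"
    and Y: "prob_space.indep_vars N (\<lambda>_. borel) Y I"
    and eq: "\<And>i. i \<in> I \<Longrightarrow> distr M borel (X i) = distr N borel (Y i)"
  shows "distr M borel (\<lambda>\<omega>. \<Sum>i\<in>I. X i \<omega>) = distr N borel (\<lambda>\<omega>. \<Sum>i\<in>I. Y i \<omega>)"
proof -
  have sum_distr: "distr L borel (\<lambda>\<omega>. \<Sum>i\<in>I. W i \<omega>) =
      distr (\<Pi>\<^sub>M i\<in>I. distr L borel (W i)) borel (\<lambda>f. \<Sum>i\<in>I. f i)"
    if "prob_space L" and W: "prob_space.indep_vars L (\<lambda>_. borel) W I"
    for L :: "'c measure" and W :: "'i \<Rightarrow> 'c \<Rightarrow> real"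
  proof -
    interpret prob_space L by fact
    have rv: "\<And>i. i \<in> I \<Longrightarrow> random_variable borel (W i)"
      using W by (auto simp: indep_vars_def)
    have "distr (\<Pi>\<^sub>M i\<in>I. distr L borel (W i)) borel (\<lambda>f. \<Sum>i\<in>I. f i) =
        distr (distr L (\<Pi>\<^sub>M i\<in>I. borel) (\<lambda>\<omega>. \<lambda>i\<in>I. W i \<omega>)) borel (\<lambda>f. \<Sum>i\<in>I. f i)"
      using indep_vars_iff_distr_eq_PiM'[of I W "\<lambda>_. borel"] rv W \<open>I \<noteq> {}\<close> by simp
    also have "\<dots> = distr L borel ((\<lambda>f. \<Sum>i\<in>I. f i) \<circ> (\<lambda>\<omega>. \<lambda>i\<in>I. W i \<omega>))"
      using rv by (intro distr_distr) (auto intro!: measurable_restrict)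
    also have "\<dots> = distr L borel (\<lambda>\<omega>. \<Sum>i\<in>I. W i \<omega>)"
      by (rule distr_cong) auto
    finally show ?thesis by simp
  qed
  have "(\<Pi>\<^sub>M i\<in>I. distr M borel (X i)) = (\<Pi>\<^sub>M i\<in>I. distr N borel (Y i))"
    using eq by (rule PiM_cong[OF refl])
  then show ?thesis using sum_distr[OF assms(1) X] sum_distr[OF assms(2) Y] by simp
qed

text \<open>The family is compared with the coordinates of the product \<open>Q\<close> of Bernoulli
  laws, where the sum counts the true coordinates and is binomial.\<close>

lemma distr_sum_bernoulli:
  fixes X :: "'i \<Rightarrow> 'a \<Rightarrow> real"
  assumes "prob_space M" "finite I" "I \<noteq> {}" "p \<in> {0..1}"
    and X: "prob_space.indep_vars M (\<lambda>_. borel) X I"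
    and law: "\<And>i. i \<in> I \<Longrightarrow> distr M borel (X i) = distr (measure_pmf (bernoulli_pmf p)) borel of_bool"
  shows "distr M borel (\<lambda>\<omega>. \<Sum>i\<in>I. X i \<omega>) = distr (measure_pmf (binomial_pmf (card I) p)) borel real"
proof -
  define Q where "Q = Pi_pmf I False (\<lambda>_. bernoulli_pmf p)"
  have indep: "prob_space.indep_vars Q (\<lambda>_. borel) (\<lambda>i f. of_bool (f i) :: real) I"
    unfolding Q_def
    by (rule prob_space.indep_vars_compose2[OF measure_pmf.prob_space_axioms indep_vars_Pi_pmf])
      (use \<open>finite I\<close> in auto)
  have marginal: "distr M borel (X i) = distr Q borel (\<lambda>f. of_bool (f i))" if "i \<in> I" for i
  proof -
    have "distr (measure_pmf (bernoulli_pmf p)) borel (of_bool :: bool \<Rightarrow> real) =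
        distr (measure_pmf (map_pmf (\<lambda>f. f i) Q)) borel of_bool"
      unfolding Q_def using that \<open>finite I\<close> by (simp add: Pi_pmf_component)
    also have "\<dots> = distr Q borel (\<lambda>f. of_bool (f i))"
      by (simp add: map_pmf_rep_eq distr_distr comp_def)
    finally show ?thesis using law[OF that] by simp
  qed
  have "distr M borel (\<lambda>\<omega>. \<Sum>i\<in>I. X i \<omega>) = distr Q borel (\<lambda>f. \<Sum>i\<in>I. of_bool (f i))"
    by (rule distr_sum_cong[OF \<open>prob_space M\<close> measure_pmf.prob_space_axioms \<open>I \<noteq> {}\<close> X indep marginal])
  also have "\<dots> = distr Q borel (real \<circ> (\<lambda>f. card {x \<in> I. f x}))"
    using \<open>finite I\<close> by (intro distr_cong) (auto simp: sum.If_cases of_bool_def Int_def)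
  also have "\<dots> = distr (map_pmf (\<lambda>f. card {x \<in> I. f x}) Q) borel real"
    by (simp add: map_pmf_rep_eq distr_distr)
  also have "map_pmf (\<lambda>f. card {x \<in> I. f x}) Q = binomial_pmf (card I) p"
    unfolding Q_def using assms by (intro binomial_pmf_altdef'[symmetric]) auto
  finally show ?thesis .
qed

text \<open>The two masses add up to 1, so almost surely \<open>X\<close> takes only the values
  \<open>s\<close> and \<open>t\<close>, and the rescaled variable is the indicator of
  \<open>X = t\<close>.\<close>

lemma (in prob_space) distr_two_point:
  fixes X :: "'a \<Rightarrow> real"
  assumes X: "X \<in> borel_measurable M" and "s \<noteq> t"
    and s: "prob {\<omega> \<in> space M. X \<omega> = s} = 1 - q" and t: "prob {\<omega> \<in> space M. X \<omega> = t} = q"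
  shows "distr M borel (\<lambda>\<omega>. (X \<omega> - s) / (t - s)) = distr (measure_pmf (bernoulli_pmf q)) borel of_bool"
proof -
  have [measurable]: "X \<in> borel_measurable M" by fact
  have q: "0 \<le> q" "q \<le> 1" using s t measure_nonneg prob_le_1 by (metis, metis)
  let ?T = "\<lambda>\<omega>. X \<omega> = t"
  have T: "?T \<in> measurable M (count_space UNIV)" by measurable
  have "prob ({\<omega> \<in> space M. X \<omega> = s} \<union> {\<omega> \<in> space M. X \<omega> = t}) = 1"
    by (subst finite_measure_Union) (use s t \<open>s \<noteq> t\<close> in auto)
  then have "AE \<omega> in M. \<omega> \<in> {\<omega> \<in> space M. X \<omega> = s} \<union> {\<omega> \<in> space M. X \<omega> = t}"
    by (intro AE_prob_1)
  then have "AE \<omega> in M. (X \<omega> - s) / (t - s) = (of_bool \<circ> ?T) \<omega>"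
    by eventually_elim (use \<open>s \<noteq> t\<close> in auto)
  then have "distr M borel (\<lambda>\<omega>. (X \<omega> - s) / (t - s)) = distr M borel (of_bool \<circ> ?T)"
    by (intro distr_cong_AE) auto
  also have "\<dots> = distr (distr M (count_space UNIV) ?T) borel of_bool"
    using T by (intro distr_distr[symmetric]) auto
  also have "distr M (count_space UNIV) ?T = measure_pmf (bernoulli_pmf q)"
  proof (rule measure_eqI_finite)
    fix c :: bool
    have "prob {\<omega> \<in> space M. X \<omega> \<noteq> t} = 1 - q"
      using prob_neg[of "\<lambda>\<omega>. X \<omega> = t"] t by simp
    moreover have "?T -` {c} \<inter> space M = {\<omega> \<in> space M. if c then X \<omega> = t else X \<omega> \<noteq> t}" by auto
    ultimately have "prob (?T -` {c} \<inter> space M) = pmf (bernoulli_pmf q) c"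
      using t q by (cases c) auto
    then show "emeasure (distr M (count_space UNIV) ?T) {c} = emeasure (measure_pmf (bernoulli_pmf q)) {c}"
      using T by (simp add: emeasure_distr emeasure_eq_measure emeasure_pmf_single)
  qed auto
  finally show ?thesis .
qed

section \<open>Moments and tails of the binomial law\<close>

lemma expectation_binomial_distr:
  fixes Z :: "'a \<Rightarrow> real" and f :: "real \<Rightarrow> real"
  assumes "Z \<in> borel_measurable M" and "distr M borel Z = distr (measure_pmf (binomial_pmf n p)) borel real"
    and "p \<in> {0..1}" and [measurable]: "f \<in> borel_measurable borel"
  shows "(\<integral>\<omega>. f (Z \<omega>) \<partial>M) = (\<Sum>j\<le>n. Bernstein n j p * f (real j))"
proof -
  have "(\<integral>\<omega>. f (Z \<omega>) \<partial>M) = (\<integral>x. f x \<partial>distr M borel Z)"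
    using assms by (subst integral_distr) auto
  also have "\<dots> = (\<integral>j. f (real j) \<partial>measure_pmf (binomial_pmf n p))"
    unfolding assms(2) by (subst integral_distr) auto
  finally show ?thesis using assms(3) by (simp add: expectation_binomial_pmf' Bernstein_def)
qed

text \<open>The binomial masses are written as Bernstein polynomials in order to use their
  positivity and moment identities.\<close>

lemma lattice_law_Bernstein:
  assumes "1 \<le> n" "0 < p" "p < 1" shows "lattice_law (\<lambda>j. Bernstein n j p) n"
  using assms by unfold_locales (auto intro: Bernstein_pos)

lemma mom_Bernstein:
  assumes "lattice_law (\<lambda>j. Bernstein n j p) n"
  shows "lattice_law.mom (\<lambda>j. Bernstein n j p) n 1 0 = n * p"
    and "lattice_law.mom (\<lambda>j. Bernstein n j p) n 2 0 = n * p * (1 - p) + (n * p)\<^sup>2"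
proof -
  interpret lattice_law "\<lambda>j. Bernstein n j p" n by fact
  have 1: "(\<Sum>j\<le>n. Bernstein n j p * real j) = n * p"
    using sum_k_Bernstein[of n p] by (simp add: mult.commute)
  then show "mom 1 0 = n * p" by (simp add: mom_def atLeast0AtMost)
  \<comment> \<open>Splitting j^2 as j(j - 1) + j reduces the second moment to the factorial
    moment.\<close>
  have "(\<Sum>j\<le>n. Bernstein n j p * (real j)\<^sup>2) =
      (\<Sum>j\<le>n. real j * (real j - 1) * Bernstein n j p) + (\<Sum>j\<le>n. Bernstein n j p * real j)"
    by (subst sum.distrib[symmetric]) (intro sum.cong refl, simp add: algebra_simps power2_eq_square)
  then show "mom 2 0 = n * p * (1 - p) + (n * p)\<^sup>2"
    unfolding sum_kk_Bernstein 1 by (simp add: mom_def atLeast0AtMost algebra_simps power2_eq_square)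
qed

lemma tails_eq_mom:
  assumes law: "lattice_law (\<lambda>j. Bernstein n j p) n"
    and Z[measurable]: "Z \<in> borel_measurable N"
    and distr: "distr N borel Z = distr (measure_pmf (binomial_pmf n p)) borel real"
    and p: "p \<in> {0..1}"
  shows "tail_p N Z k = lattice_law.mom (\<lambda>j. Bernstein n j p) n 0 k"
    and "tail_e N Z k = lattice_law.mom (\<lambda>j. Bernstein n j p) n 1 k"
    and "tail_v N Z k = lattice_law.mom (\<lambda>j. Bernstein n j p) n 2 k"
    and "Psi N Z k = lattice_law.psi (\<lambda>j. Bernstein n j p) n k"
    and "measure N {\<omega> \<in> space N. Z \<omega> = real n} = p ^ n"
proof -
  interpret lattice_law "\<lambda>j. Bernstein n j p" n by fact
  have tail: "(\<integral>\<omega>. Z \<omega> ^ r * indicat_real {real k..} (Z \<omega>) \<partial>N) = mom r k" for r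
  proof -
    have "(\<integral>\<omega>. Z \<omega> ^ r * indicat_real {real k..} (Z \<omega>) \<partial>N) =
        (\<Sum>j\<le>n. Bernstein n j p * (real j ^ r * indicat_real {real k..} (real j)))"
      by (rule expectation_binomial_distr[OF Z distr p]) measurable
    also have "\<dots> = (\<Sum>j=k..n. Bernstein n j p * (real j ^ r * indicat_real {real k..} (real j)))"
      by (rule sum.mono_neutral_right) auto
    also have "\<dots> = mom r k" unfolding mom_def by (intro sum.cong) auto
    finally show ?thesis .
  qed
  have prob: "measure N {\<omega> \<in> space N. Z \<omega> \<in> S} = (\<integral>\<omega>. indicat_real S (Z \<omega>) \<partial>N)"
    if [measurable]: "S \<in> sets borel" for S
  proof -
    have "(\<integral>\<omega>. indicat_real S (Z \<omega>) \<partial>N) = (\<integral>\<omega>. indicat_real {\<omega> \<in> space N. Z \<omega> \<in> S} \<omega> \<partial>N)"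
      by (rule Bochner_Integration.integral_cong) (auto simp: indicator_def)
    then show ?thesis by (simp add: Int_def conj_commute)
  qed
  show p: "tail_p N Z k = mom 0 k"
    using prob[of "{real k..}"] tail[of 0] by (simp add: tail_p_def)
  show e: "tail_e N Z k = mom 1 k" using tail[of 1] by (simp add: tail_e_def)
  show v: "tail_v N Z k = mom 2 k" using tail[of 2] by (simp add: tail_v_def)
  show "Psi N Z k = psi k" by (simp add: Psi_def psi_def p e v)
  have "measure N {\<omega> \<in> space N. Z \<omega> = real n} = (\<Sum>j\<le>n. Bernstein n j p * indicat_real {real n} (real j))"
    using prob[of "{real n}"] expectation_binomial_distr[OF Z distr \<open>p \<in> {0..1}\<close>, of "indicat_real {real n}"] by simp
  also have "\<dots> = (\<Sum>j\<in>{n}. Bernstein n j p * indicat_real {real n} (real j))"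
    by (rule sum.mono_neutral_right) auto
  also have "\<dots> = p ^ n" by (simp add: Bernstein_def)
  finally show "measure N {\<omega> \<in> space N. Z \<omega> = real n} = p ^ n" .
qed

section \<open>Agreement with the piecewise formula\<close>

text \<open>Clauses of \<open>P2\<close> that hold simultaneously are consistent because each
  evaluates the same infimum; the value is unique because some clause always applies.\<close>

lemma bound_eq_P2:
  assumes law: "lattice_law (\<lambda>j. Bernstein n j p) n"
    and Z: "Z \<in> borel_measurable N"
    and distr: "distr N borel Z = distr (measure_pmf (binomial_pmf n p)) borel real"
    and p: "p \<in> {0..1}" and w: "w \<le> real n"
  shows "lattice_law.bound (\<lambda>j. Bernstein n j p) n w = ereal (P2 N Z n p w)"
proof -
  interpret lattice_law "\<lambda>j. Bernstein n j p" n by fact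
  note tails = tails_eq_mom[OF law Z distr p]
  note mom = mom_Bernstein[OF law]
  have mean: "bound w = ereal 1" if "w \<le> n * p"
    using bound_below_mean that mom by (simp add: one_ereal_def)
  have first: "bound w = ereal (n * p * (1 - p) / ((w - n * p)\<^sup>2 + n * p * (1 - p)))"
    if "n * p < w" "w \<le> psi 0"
    using bound_first[of w] that unfolding mom by (simp add: power2_diff algebra_simps)
  \<comment> \<open>Since \<open>psi (n - 1) = n\<close> and \<open>w \<le> n\<close>, the last
    clause concerns only \<open>w = n\<close>.\<close>
  have last: "bound w = ereal (p ^ n)" if "psi (n - 1) \<le> w"
    using bound_last w that unfolding psi_last by (simp add: Bernstein_def)
  have cover: "w \<le> n * p \<or> (n * p < w \<and> w \<le> psi 0) \<or>
      (\<exists>k. 1 \<le> k \<and> k \<le> n - 1 \<and> psi (k - 1) < w \<and> w \<le> psi k)"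
  proof (cases "w \<le> psi 0")
    case False
    \<comment> \<open>Minimality gives \<open>psi (k - 1) < w\<close> directly, whatever the order
      of the values of \<open>psi\<close>.\<close>
    define k where "k = (LEAST k. w \<le> psi k)"
    have ex: "w \<le> psi (n - 1)" using w unfolding psi_last .
    have "w \<le> psi k" unfolding k_def using ex by (rule LeastI)
    moreover have "k \<le> n - 1" unfolding k_def using ex by (rule Least_le)
    moreover have "k \<noteq> 0" using \<open>w \<le> psi k\<close> False by metis
    moreover have "\<not> w \<le> psi (k - 1)" using \<open>k \<noteq> 0\<close> unfolding k_def by (intro not_less_Least) simp
    ultimately have "1 \<le> k \<and> k \<le> n - 1 \<and> psi (k - 1) < w \<and> w \<le> psi k" by simp
    then show ?thesis by blast
  qed auto
  have "\<exists>y. bound w = ereal y"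
    using cover
  proof (elim disjE exE conjE)
    show ?thesis if "w \<le> n * p" using mean[OF that] by (rule exI)
    show ?thesis if "n * p < w" "w \<le> psi 0" using first[OF that] by (rule exI)
    show ?thesis if "1 \<le> k" "k \<le> n - 1" "psi (k - 1) < w" "w \<le> psi k" for k
      using bound_middle[OF that] by (rule exI)
  qed
  then obtain y where y: "bound w = ereal y" ..
  have "P2 N Z n p w = y"
    unfolding P2_def tails
  proof (rule the_equality)
    show "(w \<le> n * p \<longrightarrow> y = 1) \<and>
     (n * p < w \<and> w \<le> psi 0 \<longrightarrow> y = n * p * (1 - p) / ((w - n * p)\<^sup>2 + n * p * (1 - p))) \<and>
     (\<forall>k. 1 \<le> k \<and> k \<le> n - 1 \<and> psi (k - 1) < w \<and> w \<le> psi k \<longrightarrow>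
        y = (mom 2 k * mom 0 k - (mom 1 k)\<^sup>2) / (w\<^sup>2 * mom 0 k - 2 * w * mom 1 k + mom 2 k)) \<and>
     (psi (n - 1) \<le> w \<longrightarrow> y = p ^ n)"
    proof (intro conjI allI impI; (elim conjE)?)
      show "y = 1" if "w \<le> n * p" using y mean[OF that] by simp
      show "y = n * p * (1 - p) / ((w - n * p)\<^sup>2 + n * p * (1 - p))" if "n * p < w" "w \<le> psi 0"
        using y first[OF that] by simp
      show "y = (mom 2 k * mom 0 k - (mom 1 k)\<^sup>2) / (w\<^sup>2 * mom 0 k - 2 * w * mom 1 k + mom 2 k)"
        if "1 \<le> k" "k \<le> n - 1" "psi (k - 1) < w" "w \<le> psi k" for k
        using y bound_middle[OF that] by simp
      show "y = p ^ n" if "psi (n - 1) \<le> w" using y last[OF that] by simp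
    qed
  next
    fix y' assume *: "(w \<le> n * p \<longrightarrow> y' = 1) \<and>
     (n * p < w \<and> w \<le> psi 0 \<longrightarrow> y' = n * p * (1 - p) / ((w - n * p)\<^sup>2 + n * p * (1 - p))) \<and>
     (\<forall>k. 1 \<le> k \<and> k \<le> n - 1 \<and> psi (k - 1) < w \<and> w \<le> psi k \<longrightarrow>
        y' = (mom 2 k * mom 0 k - (mom 1 k)\<^sup>2) / (w\<^sup>2 * mom 0 k - 2 * w * mom 1 k + mom 2 k)) \<and>
     (psi (n - 1) \<le> w \<longrightarrow> y' = p ^ n)"
    from cover show "y' = y"
    proof (elim disjE exE conjE)
      assume "w \<le> n * p" then show ?thesis using * y mean by simp
    next
      assume "n * p < w" "w \<le> psi 0" then show ?thesis using * y first by simp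
    next
      fix k assume k: "1 \<le> k" "k \<le> n - 1" "psi (k - 1) < w" "w \<le> psi k"
      then have "y' = (mom 2 k * mom 0 k - (mom 1 k)\<^sup>2) / (w\<^sup>2 * mom 0 k - 2 * w * mom 1 k + mom 2 k)"
        using * by blast
      then show ?thesis using y bound_middle[OF k] by simp
    qed
  qed
  with y show ?thesis by simp
qed

section \<open>Rescaling and conclusion\<close>

text \<open>Substituting \<open>x = c * (y - a)\<close> multiplies numerator and denominator by
  \<open>c\<^sup>2\<close>.\<close>

lemma P2_tilde_eq_bound:
  fixes c :: real
  assumes law: "lattice_law (\<lambda>j. Bernstein n j p) n"
    and S: "S \<in> borel_measurable M"
    and distr: "distr M borel S = distr (measure_pmf (binomial_pmf n p)) borel real"
    and p: "p \<in> {0..1}" and c: "0 < c"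
    and G: "\<And>\<omega>. (\<Sum>i=1..n. G i \<omega>) = c * (S \<omega> - a)"
  shows "P2_tilde M n G u = lattice_law.bound (\<lambda>j. Bernstein n j p) n (a + u / c)"
proof -
  interpret lattice_law "\<lambda>j. Bernstein n j p" n by fact
  have scale: "(max (c * s - c * t) 0)\<^sup>2 = c\<^sup>2 * (max (s - t) 0)\<^sup>2" for s t
  proof -
    have "max (c * s - c * t) 0 = c * max (s - t) 0"
      using c by (auto simp: max_def algebra_simps)
    then show ?thesis by (simp add: power_mult_distrib)
  qed
  have "(\<lambda>y. c * (y - a)) ` {..a + u / c} = {..u}"
  proof (intro equalityI subsetI)
    fix x assume "x \<in> {..u}"
    then show "x \<in> (\<lambda>y. c * (y - a)) ` {..a + u / c}"
      using c by (intro image_eqI[of _ _ "a + x / c"]) (auto simp: divide_right_mono)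
  qed (use c in \<open>auto simp: field_simps\<close>)
  then have "P2_tilde M n G u = (INF x\<in>(\<lambda>y. c * (y - a)) ` {..a + u / c}.
      ext_quot (\<integral>\<omega>. (max ((\<Sum>i=1..n. G i \<omega>) - x) 0)\<^sup>2 \<partial>M) ((max (u - x) 0)\<^sup>2))"
    unfolding P2_tilde_def by simp
  also have "\<dots> = (INF y\<in>{..a + u / c}.
      ext_quot (\<integral>\<omega>. (max ((\<Sum>i=1..n. G i \<omega>) - c * (y - a)) 0)\<^sup>2 \<partial>M) ((max (u - c * (y - a)) 0)\<^sup>2))"
    by (simp add: image_image)
  also have "\<dots> = bound (a + u / c)"
    unfolding bound_def
  proof (rule INF_cong[OF refl])
    fix y
    have "(\<integral>\<omega>. (max ((\<Sum>i=1..n. G i \<omega>) - c * (y - a)) 0)\<^sup>2 \<partial>M) =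
        (\<integral>\<omega>. c\<^sup>2 * (max (S \<omega> - y) 0)\<^sup>2 \<partial>M)"
      unfolding G scale[symmetric] by (simp add: algebra_simps)
    also have "\<dots> = c\<^sup>2 * stop_loss 2 y"
      using expectation_binomial_distr[OF S distr p, of "\<lambda>s. (max (s - y) 0)\<^sup>2"]
      by (simp add: stop_loss_def)
    finally have num: "(\<integral>\<omega>. (max ((\<Sum>i=1..n. G i \<omega>) - c * (y - a)) 0)\<^sup>2 \<partial>M) = c\<^sup>2 * stop_loss 2 y" .
    have den: "(max (u - c * (y - a)) 0)\<^sup>2 = c\<^sup>2 * (max (a + u / c - y) 0)\<^sup>2"
      using scale[of "a + u / c" y] c by (simp add: algebra_simps)
    show "ext_quot (\<integral>\<omega>. (max ((\<Sum>i=1..n. G i \<omega>) - c * (y - a)) 0)\<^sup>2 \<partial>M) ((max (u - c * (y - a)) 0)\<^sup>2) =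
        ext_quot (stop_loss 2 y) ((max (a + u / c - y) 0)\<^sup>2)"
      \<comment> \<open>As \<open>c\<^sup>2\<close> is nonzero, it cancels and the denominators
        vanish together, so infinite values also correspond.\<close>
      unfolding num den using c by (simp add: ext_quot_def)
  qed
  finally show ?thesis .
qed

text \<open>The case split is forced: for \<open>u > n * B\<close> the choice
  \<open>x = n * B\<close> makes the numerator vanish, so the infimum is 0, while the last clause of
  \<open>P2\<close> would give \<open>p ^ n\<close>.\<close>

theorem proposition1:
  fixes M :: "'a measure" and N :: "'b measure"
    and G :: "nat \<Rightarrow> 'a \<Rightarrow> real" and R :: "nat \<Rightarrow> 'b \<Rightarrow> real" and Z :: "'b \<Rightarrow> real"
    and n :: nat and A B p u :: real
  assumes "n \<ge> 1" and "A > 0" and "B > 0"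
    and "p = A\<^sup>2 / (A\<^sup>2 + B\<^sup>2)"
    and "prob_space M"
    and "prob_space.indep_vars M (\<lambda>_. borel) G {1..n}"
    and "\<And>i. i \<in> {1..n} \<Longrightarrow>
           measure M {\<omega> \<in> space M. G i \<omega> = - (A\<^sup>2 / B)} = B\<^sup>2 / (A\<^sup>2 + B\<^sup>2)"
    and "\<And>i. i \<in> {1..n} \<Longrightarrow>
           measure M {\<omega> \<in> space M. G i \<omega> = B} = A\<^sup>2 / (A\<^sup>2 + B\<^sup>2)"
    and "prob_space N"
    and "prob_space.indep_vars N (\<lambda>_. borel) R {1..n}"
    and "\<And>i. i \<in> {1..n} \<Longrightarrow>
           distr N borel (R i) = distr (measure_pmf (bernoulli_pmf p)) borel of_bool"
    and "Z = (\<lambda>\<omega>. \<Sum>i=1..n. R i \<omega>)"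
  shows "P2_tilde M n G u =
           (if u \<le> n * B then ereal (P2 N Z n p (n * p + u * (1 - p) / B)) else 0) \<and>
         measure N {\<omega> \<in> space N. Z \<omega> = real n} = p ^ n \<and>
         Psi N Z (n - 1) = n"
proof -
  interpret M: prob_space M by fact
  interpret N: prob_space N by fact
  \<comment> \<open>This is the distance between the two values of each \<open>G i\<close>. Its
    reciprocal is the factor \<open>(1 - p) / B\<close>, and \<open>c * p\<close> is the shift that
    takes the lower value to 0.\<close>
  define c where "c = B + A\<^sup>2 / B"
  have AB: "0 < A\<^sup>2 + B\<^sup>2" using \<open>A > 0\<close> by (simp add: add_pos_nonneg)
  have p: "0 < p" "p < 1" "p \<in> {0..1}" and q: "B\<^sup>2 / (A\<^sup>2 + B\<^sup>2) = 1 - p"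
    using AB \<open>A > 0\<close> \<open>B > 0\<close> by (auto simp: \<open>p = _\<close> field_simps)
  have c: "0 < c" using \<open>B > 0\<close> by (simp add: c_def add_pos_nonneg)
  have c_eq: "c = (A\<^sup>2 + B\<^sup>2) / B"
    using \<open>B > 0\<close> by (simp add: c_def field_simps power2_eq_square)
  have cp: "c * p = A\<^sup>2 / B"
    using AB by (simp add: c_eq \<open>p = _\<close>)
  have cq: "1 / c = (1 - p) / B"
    using \<open>B > 0\<close> by (simp add: c_eq power2_eq_square flip: q)
  have law: "lattice_law (\<lambda>j. Bernstein n j p) n"
    using \<open>n \<ge> 1\<close> p by (intro lattice_law_Bernstein)
  interpret lattice_law "\<lambda>j. Bernstein n j p" n by fact
  have ne: "{1..n} \<noteq> {}" using \<open>n \<ge> 1\<close> by simp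

  have Z: "Z \<in> borel_measurable N"
    using N.indep_vars_def2[of "\<lambda>_. borel" R "{1..n}"] assms(10) unfolding \<open>Z = _\<close> by (auto intro!: borel_measurable_sum)
  have Z_law: "distr N borel Z = distr (measure_pmf (binomial_pmf n p)) borel real"
    using distr_sum_bernoulli[OF N.prob_space_axioms _ ne p(3) assms(10,11)] by (simp add: \<open>Z = _\<close>)

  \<comment> \<open>The affine map sends the lower value of \<open>G i\<close> to 0 and the upper
    value to 1, producing Bernoulli variables.\<close>
  define X where "X = (\<lambda>i \<omega>. (G i \<omega> - (- (A\<^sup>2 / B))) / (B - (- (A\<^sup>2 / B))))"
  define S where "S = (\<lambda>\<omega>. \<Sum>i=1..n. X i \<omega>)"
  have G_meas: "G i \<in> borel_measurable M" if "i \<in> {1..n}" for i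
    using M.indep_vars_def2[of "\<lambda>_. borel" G "{1..n}"] assms(6) that by simp
  then have S: "S \<in> borel_measurable M" by (auto simp: S_def X_def)
  have X_indep: "M.indep_vars (\<lambda>_. borel) X {1..n}"
    unfolding X_def by (rule M.indep_vars_compose2[OF assms(6)]) auto
  have X_law: "distr M borel (X i) = distr (measure_pmf (bernoulli_pmf p)) borel of_bool"
    if i: "i \<in> {1..n}" for i
    unfolding X_def
  proof (rule M.distr_two_point)
    show "- (A\<^sup>2 / B) \<noteq> B" using c by (simp add: c_def)
  qed (use G_meas[OF i] assms(7,8)[OF i] q \<open>p = _\<close> in auto)
  have S_law: "distr M borel S = distr (measure_pmf (binomial_pmf n p)) borel real"
    using distr_sum_bernoulli[OF M.prob_space_axioms _ ne p(3) X_indep X_law] by (simp add: S_def)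
  have G_sum: "(\<Sum>i=1..n. G i \<omega>) = c * (S \<omega> - n * p)" for \<omega>
  proof -
    have "(\<Sum>i=1..n. G i \<omega>) = (\<Sum>i=1..n. c * X i \<omega> - c * p)"
      using c unfolding cp by (intro sum.cong refl) (simp add: X_def c_def[symmetric])
    then show ?thesis by (simp add: S_def sum_subtractf sum_distrib_left right_diff_distrib)
  qed

  define w where "w = n * p + u * (1 - p) / B"
  have "n * p + u / c = w" using cq by (simp add: w_def divide_inverse mult.assoc)
  then have tilde: "P2_tilde M n G u = bound w"
    using P2_tilde_eq_bound[OF law S S_law p(3) c G_sum] by simp
  have w_le: "w \<le> real n \<longleftrightarrow> u \<le> n * B"
  proof -
    have "w \<le> real n \<longleftrightarrow> u * (1 - p) \<le> (n * B) * (1 - p)"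
      using \<open>B > 0\<close> by (simp add: w_def field_simps)
    then show ?thesis using p by simp
  qed
  have "P2_tilde M n G u = (if u \<le> n * B then ereal (P2 N Z n p w) else 0)"
    using bound_eq_P2[OF law Z Z_law p(3)] bound_beyond[of w] w_le unfolding tilde by auto
  then show ?thesis
    using tails_eq_mom(4,5)[OF law Z Z_law p(3)] psi_last by (simp add: w_def)
qed

end
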